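(* Let $A$ and $B$ be two quantum systems of any arbitrary finite dimension, and let $\mathcal S$ be the SWAP channel between $A$ and $B$, regarded as a bipartite unitary channel with Alice's input $A$, Bob's input $B$, Alice's output $A'=B$ and Bob's output $B'=A$. Then $C(\mathcal S)=2$.
   Context: All systems are finite-dimensional quantum systems; system $X$ has complex Hilbert space $\mathcal H_X$ of dimension $d_X$, and the composite system $XY$ has Hilbert space $\mathcal H_X\otimes\mathcal H_Y$. $\mathsf{St}(X)$ is the set of density operators on $\mathcal H_X$. $\mathfrak C(X,Y)$ is the set of quantum channels (completely positive trace-preserving linear maps) from operators on $\mathcal H_X$ to operators on $\mathcal H_Y$, and $\mathfrak C(X)=\mathfrak C(X,X)$. $\mathcal I_X$ is the identity channel on $X$. $\|X\|_1=\mathrm{Tr}\sqrt{X^\dagger X}$. For a Hermitian-preserving linear map $\mathcal L$ with input system $X$, the diamond norm is $\|\mathcal L\|_\diamond=\sup_{\rho\in\mathsf{St}(EX)}\|(\mathcal I_E\otimes\mathcal L)(\rho)\|_1$ with $E\cong X$. For a bipartite unitary channel $\mathcal U:\rho\mapsto U\rho U^\dagger$ with $U:\mathcal H_A\otimes\mathcal H_B\to\mathcal H_{A'}\otimes\mathcal H_{B'}$ unitary, let $\mathcal T(\mathcal U)=(\mathcal I_A\otimes\mathcal U)\circ(\mathcal S_{AA}\otimes\mathcal I_B)\circ(\mathcal I_A\otimes\mathcal U^{-1})\in\mathfrak C(AA'B')$, where $\mathcal S_{AA}$ is the swap of two copies of $A$. The causal influence of $\mathcal U$ (from $A$ to $B'$)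 is $$C(\mathcal U)=\inf_{\mathcal C\in\mathfrak C(AA')}\|\mathcal T(\mathcal U)-\mathcal C\otimes\mathcal I_{B'}\|_\diamond .$$ The SWAP gate is the unitary $S:\mathcal H_A\otimes\mathcal H_B\to\mathcal H_B\otimes\mathcal H_A$, $S(|\psi\rangle\otimes|\varphi\rangle)=|\varphi\rangle\otimes|\psi\rangle$, and $\mathcal S$ is the corresponding channel $\rho\mapsto S\rho S^\dagger$.
   Formalization: The system A is assumed to have dimension at least 2 (B is arbitrary); for a one-dimensional A the claim fails, since the swap of two copies of A is then the identity and C(S) = 0. *)

theory Defs
  imports "HOL-Analysis.Analysis"
begin

text \<open>A quantum system of dimension \<open>CARD('x)\<close> is represented by the Hilbert space
  \<open>complex ^ 'x\<close>, a composite system by a product index type. Operators from system \<open>'x\<close> to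
  system \<open>'y\<close> have type \<open>complex ^ 'x ^ 'y\<close>.\<close>

type_synonym 'x op = "complex ^ 'x ^ 'x"

definition cinner :: "complex ^ 'x::finite \<Rightarrow> complex ^ 'x \<Rightarrow> complex" where
  "cinner u v = (\<Sum>i\<in>UNIV. cnj (u $ i) * v $ i)"

definition dagger :: "complex ^ 'x::finite ^ 'y::finite \<Rightarrow> complex ^ 'y ^ 'x" where
  "dagger A = (\<chi> i j. cnj (A $ j $ i))"

definition unitary :: "complex ^ 'x::finite ^ 'y::finite \<Rightarrow> bool" where
  "unitary U \<longleftrightarrow> dagger U ** U = mat 1 \<and> U ** dagger U = mat 1"

definition psd :: "'x::finite op \<Rightarrow> bool" where
  "psd A \<longleftrightarrow> (\<forall>v. cinner v (A *v v) \<in> \<real>\<^sub>\<ge>\<^sub>0)"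

definition density :: "'x::finite op set" where
  "density = {\<rho>. psd \<rho> \<and> trace \<rho> = 1}"

definition psd_sqrt :: "'x::finite op \<Rightarrow> 'x op" where
  "psd_sqrt A = (THE R. psd R \<and> R ** R = A)"

definition trace_norm :: "'x::finite op \<Rightarrow> real" where
  "trace_norm X = Re (trace (psd_sqrt (dagger X ** X)))"

definition cscale :: "complex \<Rightarrow> 'x::finite op \<Rightarrow> 'x op" where
  "cscale c A = (\<chi> i j. c * A $ i $ j)"

definition tensor_vec :: "complex ^ 'x::finite \<Rightarrow> complex ^ 'y::finite \<Rightarrow> complex ^ ('x \<times> 'y)" where
  "tensor_vec u v = (\<chi> p. u $ fst p * v $ snd p)"

definition tensor_op :: "'x::finite op \<Rightarrow> 'y::finite op \<Rightarrow> ('x \<times> 'y) op" where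
  "tensor_op A B = (\<chi> p q. A $ fst p $ fst q * B $ snd p $ snd q)"

definition unit_op :: "'x::finite \<Rightarrow> 'x \<Rightarrow> 'x op" where
  "unit_op i j = (\<chi> k l. if k = i \<and> l = j then 1 else 0)"

abbreviation clinear_map :: "('x::finite op \<Rightarrow> 'y::finite op) \<Rightarrow> bool" where
  "clinear_map \<equiv> Vector_Spaces.linear cscale cscale"

text \<open>The linear extension of \<open>A \<otimes> B \<mapsto> L A \<otimes> M B\<close>, obtained by expanding the argument in
  matrix units; see \<open>tensor_map_tensor_op\<close> below.\<close>

definition tensor_map ::
  "('x::finite op \<Rightarrow> 'u::finite op) \<Rightarrow> ('y::finite op \<Rightarrow> 'v::finite op)
     \<Rightarrow> ('x \<times> 'y) op \<Rightarrow> ('u \<times> 'v) op" where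
  "tensor_map L M X =
     (\<Sum>i\<in>UNIV. \<Sum>j\<in>UNIV. \<Sum>k\<in>UNIV. \<Sum>l\<in>UNIV.
        cscale (X $ (i, k) $ (j, l)) (tensor_op (L (unit_op i j)) (M (unit_op k l))))"

text \<open>Complete positivity: for every \<open>n\<close>, the map \<open>id\<^sub>n \<otimes> L\<close> preserves positive semidefiniteness.
  Since \<open>n\<close> is quantified, an operator on \<open>\<complex>\<^sup>n \<otimes> \<H>\<close> is given as an \<open>n \<times> n\<close> block matrix with
  blocks \<open>X i j\<close> for \<open>i, j < n\<close>.\<close>

definition block_psd :: "nat \<Rightarrow> (nat \<Rightarrow> nat \<Rightarrow> 'x::finite op) \<Rightarrow> bool" where
  "block_psd n X \<longleftrightarrow>
     (\<forall>v. (\<Sum>i<n. \<Sum>j<n. cinner (v i) (X i j *v v j)) \<in> \<real>\<^sub>\<ge>\<^sub>0)"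

definition completely_positive :: "('x::finite op \<Rightarrow> 'y::finite op) \<Rightarrow> bool" where
  "completely_positive L \<longleftrightarrow>
     (\<forall>n X. block_psd n X \<longrightarrow> block_psd n (\<lambda>i j. L (X i j)))"

definition channels :: "('x::finite op \<Rightarrow> 'y::finite op) set" where
  "channels = {L. clinear_map L \<and> completely_positive L \<and> (\<forall>X. trace (L X) = trace X)}"

definition diamond_norm :: "('x::finite op \<Rightarrow> 'y::finite op) \<Rightarrow> real" where
  "diamond_norm L = (SUP \<rho> \<in> (density :: ('x \<times> 'x) op set). trace_norm (tensor_map id L \<rho>))"

definition unitary_channel :: "complex ^ 'x::finite ^ 'y::finite \<Rightarrow> 'x op \<Rightarrow> 'y op" where
  "unitary_channel U \<rho> = U ** \<rho> ** dagger U"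

definition swap_gate :: "complex ^ ('x::finite \<times> 'y::finite) ^ ('y \<times> 'x)" where
  "swap_gate = (\<chi> p q. if p = prod.swap q then 1 else 0)"

text \<open>The canonical identification of \<open>(X \<otimes> Y) \<otimes> Z\<close> with \<open>X \<otimes> (Y \<otimes> Z)\<close>, on operators.\<close>

definition assoc_right :: "(('x::finite \<times> 'y::finite) \<times> 'z::finite) op \<Rightarrow> ('x \<times> 'y \<times> 'z) op" where
  "assoc_right M =
     (\<chi> p q. M $ ((fst p, fst (snd p)), snd (snd p)) $ ((fst q, fst (snd q)), snd (snd q)))"

definition assoc_left :: "('x::finite \<times> 'y::finite \<times> 'z::finite) op \<Rightarrow> (('x \<times> 'y) \<times> 'z) op" where
  "assoc_left M =
     (\<chi> p q. M $ (fst (fst p), snd (fst p), snd p) $ (fst (fst q), snd (fst q), snd q))"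

text \<open>For a map \<open>\<U>\<close> from \<open>AB\<close> to \<open>A'B'\<close>, with \<open>A, B, A', B'\<close> indexed by \<open>'a, 'b, 'c, 'd\<close>.\<close>

definition swap_conjugate ::
  "(('a::finite \<times> 'b::finite) op \<Rightarrow> ('c::finite \<times> 'd::finite) op)
     \<Rightarrow> ('a \<times> 'c \<times> 'd) op \<Rightarrow> ('a \<times> 'c \<times> 'd) op" where
  "swap_conjugate \<U> =
     tensor_map id \<U>
     \<circ> (assoc_right
        \<circ> tensor_map (unitary_channel (swap_gate :: complex ^ ('a \<times> 'a) ^ ('a \<times> 'a))) id
        \<circ> assoc_left)
     \<circ> tensor_map id (inv \<U>)"

definition causal_influence :: "(('a::finite \<times> 'b::finite) op \<Rightarrow> ('c::finite \<times> 'd::finite) op) \<Rightarrow> real" where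
  "causal_influence \<U> =
     (INF \<C> \<in> (channels :: (('a \<times> 'c) op \<Rightarrow> ('a \<times> 'c) op) set).
        diamond_norm (\<lambda>\<rho>. swap_conjugate \<U> \<rho>
          - (assoc_right \<circ> tensor_map \<C> id \<circ> assoc_left) \<rho>))"

lemma vector_space_cscale: "vector_space (cscale :: complex \<Rightarrow> 'x::finite op \<Rightarrow> 'x op)"
  by unfold_locales (simp_all add: cscale_def vec_eq_iff algebra_simps)

lemma op_expand: "A = (\<Sum>i\<in>UNIV. \<Sum>j\<in>UNIV. cscale (A $ i $ j) (unit_op i j))"
proof -
  have "(\<Sum>i\<in>UNIV. \<Sum>j\<in>UNIV. A $ i $ j * (if k = i \<and> l = j then 1 else 0)) = A $ k $ l" for k l
  proof -
    have "(\<Sum>i\<in>UNIV. \<Sum>j\<in>UNIV. A $ i $ j * (if k = i \<and> l = j then 1 else 0))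
        = (\<Sum>i\<in>UNIV. if k = i then \<Sum>j\<in>UNIV. (if l = j then A $ i $ j else 0) else 0)"
      by (intro sum.cong refl) (simp add: if_distrib[of "\<lambda>x. c * x" for c] cong: if_cong)
    then show ?thesis by (simp del: mult_1_right)
  qed
  then show ?thesis by (simp add: vec_eq_iff cscale_def unit_op_def)
qed

lemma clinear_map_expand:
  assumes "clinear_map L"
  shows "L A = (\<Sum>i\<in>UNIV. \<Sum>j\<in>UNIV. cscale (A $ i $ j) (L (unit_op i j)))"
proof -
  interpret Vector_Spaces.linear cscale cscale L by (rule assms)
  show ?thesis by (subst op_expand[of A]) (simp only: sum scale)
qed

lemma tensor_map_tensor_op:
  fixes A :: "'x::finite op" and B :: "'y::finite op"
  assumes "clinear_map L" "clinear_map M"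
  shows "tensor_map L M (tensor_op A B) = tensor_op (L A) (M B)"
proof -
  have fact1: "(\<Sum>i\<in>UNIV. \<Sum>j\<in>UNIV. f i j) * (\<Sum>k\<in>UNIV. \<Sum>l\<in>UNIV. g k l)
    = (\<Sum>i\<in>UNIV. \<Sum>j\<in>UNIV. \<Sum>k\<in>UNIV. \<Sum>l\<in>UNIV. f i j * g k l)"
    for f :: "'x \<Rightarrow> 'x \<Rightarrow> complex" and g :: "'y \<Rightarrow> 'y \<Rightarrow> complex"
    by (simp only: sum_distrib_right) (simp only: sum_distrib_left)
  show ?thesis
    unfolding clinear_map_expand[OF assms(1), of A] clinear_map_expand[OF assms(2), of B]
    by (simp add: vec_eq_iff tensor_map_def tensor_op_def cscale_def fact1 mult_ac)
qed

lemma swap_gate_nth: "swap_gate $ p $ q = (if q = prod.swap p then 1 else 0)"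
  by (auto simp: swap_gate_def)

lemma swap_gate_tensor_vec: "swap_gate *v tensor_vec u v = tensor_vec v u"
  by (simp add: vec_eq_iff swap_gate_nth tensor_vec_def matrix_vector_mult_def
      if_distrib[of "\<lambda>x. x * c" for c] mult.commute[of "v $ _"] cong: if_cong)

lemma dagger_swap_gate: "dagger swap_gate = swap_gate"
  by (auto simp: vec_eq_iff dagger_def swap_gate_nth)

lemma swap_gate_mult_self: "swap_gate ** swap_gate = mat 1"
  by (auto simp: vec_eq_iff swap_gate_nth matrix_matrix_mult_def mat_def
      if_distrib[of "\<lambda>x. x * c" for c] cong: if_cong)

lemma unitary_swap_gate: "unitary swap_gate"
  by (simp add: unitary_def dagger_swap_gate swap_gate_mult_self)

lemma inv_unitary_channel:
  assumes "unitary U"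
  shows "inv (unitary_channel U) = unitary_channel (dagger U)"
proof -
  have "dagger (dagger U) = U" by (simp add: dagger_def vec_eq_iff)
  moreover have "dagger U ** (U ** X ** dagger U) ** U = X" for X
    using assms by (metis matrix_mul_assoc matrix_mul_lid matrix_mul_rid unitary_def)
  moreover have "U ** (dagger U ** X ** U) ** dagger U = X" for X
    using assms by (metis matrix_mul_assoc matrix_mul_lid matrix_mul_rid unitary_def)
  ultimately show ?thesis
    by (intro inv_unique_comp) (auto simp: unitary_channel_def)
qed

end

theory Submission
  imports Defs
begin

text \<open>For the SWAP gate, the map \<open>\<T>(\<S>)\<close> exchanges \<open>A\<close> with \<open>B'\<close>, which both have the Hilbert
  space of \<open>A\<close>. On the basis state \<open>|a c b\<rangle>\<close> of \<open>AA'B'\<close> with \<open>a \<noteq> b\<close>, it leaves \<open>B'\<close> in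
  \<open>|a\<rangle>\<close>, whereas every \<open>\<C> \<otimes> \<I>\<close> leaves \<open>B'\<close> in \<open>|b\<rangle>\<close>. The two outputs are orthogonal density
  operators, at trace-norm distance 2, the largest possible value. Hence the diamond norm is 2 for
  every channel \<open>\<C>\<close>.\<close>

section \<open>The spectral theorem for Hermitian matrices\<close>

lemma cinner_add_left: "cinner (u + v) w = cinner u w + cinner v w"
  and cinner_add_right: "cinner w (u + v) = cinner w u + cinner w v"
  and cinner_diff_right: "cinner w (u - v) = cinner w u - cinner w v"
  by (simp_all add: cinner_def algebra_simps sum.distrib sum_subtractf)

lemma cinner_scale_left: "cinner (c *s u) w = cnj c * cinner u w"
  and cinner_scale_right: "cinner w (c *s u) = c * cinner w u"
  by (simp_all add: cinner_def sum_distrib_left mult_ac)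

lemma cinner_zero_left [simp]: "cinner 0 w = 0"
  and cinner_zero_right [simp]: "cinner w 0 = 0"
  by (simp_all add: cinner_def)

lemma cinner_sum_right: "cinner w (\<Sum>b\<in>B. f b) = (\<Sum>b\<in>B. cinner w (f b))"
  by (induction B rule: infinite_finite_induct) (simp_all add: cinner_add_right)

lemma cnj_cinner: "cnj (cinner u v) = cinner v u"
  by (simp add: cinner_def mult.commute)

text \<open>Links the complex inner product to the real one, so that results on real orthogonality
  and norms become applicable.\<close>

lemma Re_cinner: "Re (cinner u v) = inner u v"
  by (simp add: cinner_def inner_vec_def inner_complex_def Re_sum)

lemma cinner_self: "cinner v v = complex_of_real ((norm v)\<^sup>2)"
proof (rule complex_eqI)
  show "Re (cinner v v) = Re (complex_of_real ((norm v)\<^sup>2))"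
    by (simp add: Re_cinner power2_norm_eq_inner)
  show "Im (cinner v v) = Im (complex_of_real ((norm v)\<^sup>2))"
    by (simp add: cinner_def Im_sum)
qed

lemma cinner_self_eq_0_iff: "cinner v v = 0 \<longleftrightarrow> v = 0"
  by (simp add: cinner_self)

lemma cinner_matrix: "cinner u (A *v v) = cinner (dagger A *v u) v"
proof -
  have "cinner u (A *v v) = (\<Sum>i\<in>UNIV. \<Sum>j\<in>UNIV. cnj (u $ i) * (A $ i $ j * v $ j))"
    by (simp add: cinner_def matrix_vector_mult_def sum_distrib_left)
  also have "\<dots> = (\<Sum>j\<in>UNIV. \<Sum>i\<in>UNIV. cnj (u $ i) * (A $ i $ j * v $ j))"
    by (rule sum.swap)
  also have "\<dots> = cinner (dagger A *v u) v"
    by (simp add: cinner_def matrix_vector_mult_def dagger_def sum_distrib_left sum_distrib_right mult_ac)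
  finally show ?thesis .
qed

lemma matrix_scale: "A *v (c *s v) = c *s (A *v (v :: complex ^ 'n::finite))"
  by (simp add: vec_eq_iff matrix_vector_mult_def sum_distrib_left mult_ac)

lemma scaleR_eq_scale: "r *\<^sub>R v = complex_of_real r *s (v :: complex ^ 'n::finite)"
  by (simp add: vec_eq_iff) (simp add: scaleR_conv_of_real)

lemma continuous_on_cinner_matrix:
  "continuous_on S (\<lambda>v. cinner v (A *v v))"
  unfolding cinner_def matrix_vector_mult_def
  by (simp, intro continuous_intros)

lemma continuous_on_cinner: "continuous_on S (\<lambda>v. cinner b v)"
  unfolding cinner_def by (intro continuous_intros)

definition corthonormal :: "(complex ^ 'n::finite) set \<Rightarrow> bool" where
  "corthonormal B \<longleftrightarrow> (\<forall>a\<in>B. \<forall>b\<in>B. cinner a b = (if a = b then 1 else 0))"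

text \<open>Complex orthonormality implies orthogonality over the reals, hence real independence.
  \<open>DIM\<close> is the real dimension, twice the complex one; any finite bound suffices to pick
  an orthonormal set of maximal size.\<close>

lemma corthonormal_finite_card:
  fixes B :: "(complex ^ 'n::finite) set"
  assumes "corthonormal B"
  shows "finite B" "card B \<le> DIM(complex ^ 'n)"
proof -
  have "pairwise orthogonal B"
    using assms by (auto simp: corthonormal_def pairwise_def orthogonal_def simp flip: Re_cinner)
  moreover have "0 \<notin> B"
    using assms unfolding corthonormal_def by (metis cinner_zero_left zero_neq_one)
  ultimately have "independent B" by (rule pairwise_orthogonal_independent)
  then show "finite B" "card B \<le> DIM(complex ^ 'n)"
    using independent_bound[of B] by auto
qed

text \<open>The first-order condition at a minimum: for small \<open>t\<close> the linear term
  dominates and would change sign with \<open>t\<close>.\<close>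

lemma quadratic_nonneg_imp_linear_zero:
  fixes p q :: real
  assumes "\<And>t. 0 \<le> t * p + t\<^sup>2 * q"
  shows "p = 0"
proof (rule ccontr)
  assume p: "p \<noteq> 0"
  \<comment> \<open>With \<open>D\<close> positive and above \<open>q\<close>, the choice
    \<open>t = - p / D\<close> makes the quadratic a positive multiple of
    \<open>q - D\<close>.\<close>
  define D where "D = 1 + \<bar>q\<bar>"
  define t where "t = - p / D"
  have D: "D > 0" "q < D" by (auto simp: D_def)
  then have "t * p + t\<^sup>2 * q = p\<^sup>2 / D\<^sup>2 * (q - D)"
    by (simp add: t_def field_simps power2_eq_square)
  also have "\<dots> < 0"
    using p D by (intro mult_pos_neg divide_pos_pos) auto
  finally show False using assms[of t] by simp
qed

text \<open>Rayleigh quotient argument: the orthogonal complement of a set of eigenvectors is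
  invariant under a Hermitian \<open>A\<close>, and a maximiser of the quadratic form on its compact
  unit sphere is an eigenvector whose eigenvalue is the maximum.\<close>

lemma hermitian_eigenvector_in_complement:
  fixes A :: "'n::finite op"
  assumes herm: "dagger A = A"
    and inv: "\<And>b. b \<in> B \<Longrightarrow> \<exists>c. A *v b = c *s b"
    and ne: "x \<noteq> 0" "\<And>b. b \<in> B \<Longrightarrow> cinner b x = 0"
  obtains v m where "norm v = 1" "\<And>b. b \<in> B \<Longrightarrow> cinner b v = 0"
    "A *v v = complex_of_real m *s v"
proof -
  define S where "S = {x. \<forall>b\<in>B. cinner b x = 0}"
  have "S = (\<Inter>b\<in>B. {x. cinner b x = 0})" by (auto simp: S_def)
  then have clS: "closed S"
    by (auto intro!: closed_INT closed_Collect_eq continuous_on_cinner)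
  have Sadd: "u + v \<in> S" and Sdiff: "u - v \<in> S" and Ssc: "c *s u \<in> S" and SA: "A *v u \<in> S"
    if "u \<in> S" "v \<in> S" for u v c
  proof -
    show "u + v \<in> S" "u - v \<in> S" "c *s u \<in> S"
      using that by (auto simp: S_def cinner_add_right cinner_diff_right cinner_scale_right)
    show "A *v u \<in> S"
      unfolding S_def
    proof safe
      fix b assume "b \<in> B"
      then obtain c where "A *v b = c *s b" using inv by blast
      then show "cinner b (A *v u) = 0"
        using that \<open>b \<in> B\<close> by (simp add: cinner_matrix herm cinner_scale_left S_def)
    qed
  qed
  let ?K = "S \<inter> sphere 0 1"
  let ?f = "\<lambda>v. Re (cinner v (A *v v))"
  have "compact ?K" using clS by (intro closed_Int_compact) auto
  \<comment> \<open>Normalising \<open>x\<close> shows that the sphere in the complement is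
    nonempty.\<close>
  moreover have "complex_of_real (1 / norm x) *s x \<in> ?K"
  proof -
    have "x \<in> S" using ne by (simp add: S_def)
    moreover have "complex_of_real (1 / norm x) *s x = (1 / norm x) *\<^sub>R x"
      by (simp only: scaleR_eq_scale)
    ultimately show ?thesis using ne(1) Ssc by (metis IntI mem_sphere_0 norm_sgn sgn_div_norm
      inverse_eq_divide)
  qed
  moreover have "continuous_on ?K ?f"
    by (intro continuous_intros continuous_on_cinner_matrix)
  ultimately obtain v where v: "v \<in> ?K" "\<And>y. y \<in> ?K \<Longrightarrow> ?f y \<le> ?f v"
    using continuous_attains_sup[of ?K ?f] by blast
  define m where "m = ?f v"
  have nv: "norm v = 1" and vS: "v \<in> S" using v by auto
  have bound: "?f w \<le> m * (norm w)\<^sup>2" if "w \<in> S" for w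
  proof (cases "w = 0")
    case False
    let ?y = "complex_of_real (1 / norm w) *s w"
    have "?y = (1 / norm w) *\<^sub>R w"
      by (simp only: scaleR_eq_scale)
    then have "norm ?y = 1" using False by simp
    then have "?y \<in> ?K" using Ssc[OF that that] by simp
    then have "?f ?y \<le> m" using v unfolding m_def by blast
    moreover have "?f ?y = ?f w / (norm w)\<^sup>2"
      by (simp add: matrix_scale cinner_scale_left cinner_scale_right power2_eq_square
          flip: of_real_divide)
    ultimately have "?f w / (norm w)\<^sup>2 \<le> m" by metis
    then show ?thesis using False by (simp add: pos_divide_le_eq)
  qed simp
  \<comment> \<open>The residual of the eigenvalue equation. It lies in \<open>S\<close>, so
    \<open>v\<close> may be perturbed along it; maximality of \<open>v\<close> bounds a quadratic in
    \<open>t\<close> whose linear coefficient is twice the squared norm of \<open>u\<close>.\<close>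
  define u where "u = complex_of_real m *s v - A *v v"
  have uS: "u \<in> S" using vS unfolding u_def by (intro Sdiff Ssc SA)
  have sym: "Re (cinner u (A *v v)) = Re (cinner v (A *v u))"
    by (metis cinner_matrix herm cnj_cinner complex_cnj(1) cnj.sel(1))
  have "0 \<le> t * (2 * Re (cinner u u)) + t\<^sup>2 * (m * (norm u)\<^sup>2 - ?f u)" for t
  proof -
    let ?w = "v + complex_of_real t *s u"
    have a: "?f ?w \<le> m * (norm ?w)\<^sup>2"
      using vS uS by (intro bound Sadd Ssc)
    have b: "?f ?w = m + 2 * t * Re (cinner u (A *v v)) + t\<^sup>2 * ?f u"
      by (simp add: matrix_vector_right_distrib matrix_scale cinner_add_left cinner_add_right
          cinner_scale_left cinner_scale_right sym m_def power2_eq_square algebra_simps)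
    have c: "(norm ?w)\<^sup>2 = 1 + 2 * t * Re (cinner u v) + t\<^sup>2 * (norm u)\<^sup>2"
    proof -
      have "(norm ?w)\<^sup>2 = Re (cinner ?w ?w)" by (simp add: cinner_self)
      also have "\<dots> = Re (cinner v v) + 2 * t * Re (cinner u v) + t\<^sup>2 * Re (cinner u u)"
        using inner_commute[of u v]
        by (simp add: cinner_add_left cinner_add_right cinner_scale_left cinner_scale_right
          power2_eq_square algebra_simps Re_cinner)
      finally show ?thesis by (simp add: cinner_self nv)
    qed
    have "Re (cinner u u) = m * Re (cinner u v) - Re (cinner u (A *v v))"
      by (subst (2) u_def) (simp add: cinner_diff_right cinner_scale_right)
    then have d: "Re (cinner u (A *v v)) = m * Re (cinner u v) - Re (cinner u u)" by simp
    show ?thesis using a unfolding b c d by (simp add: algebra_simps)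
  qed
  then have "2 * Re (cinner u u) = 0" by (rule quadratic_nonneg_imp_linear_zero)
  then have "u = 0" by (simp add: cinner_self)
  then show ?thesis using that[of v m] nv vS by (auto simp: u_def S_def)
qed

text \<open>Take an orthonormal set of eigenvectors of maximal cardinality. If it did not expand
  every vector, its complement would be nonzero and would contain one more unit eigenvector.\<close>

lemma hermitian_eigenbasis:
  fixes A :: "'n::finite op"
  assumes herm: "dagger A = A"
  obtains B l where "finite B" "corthonormal B"
    "\<And>b. b \<in> B \<Longrightarrow> A *v b = complex_of_real (l b) *s b"
    "\<And>x. (\<Sum>b\<in>B. cinner b x *s b) = x"
proof -
  define P where "P B \<longleftrightarrow> corthonormal B \<and>
    (\<forall>b\<in>B. \<exists>l. A *v b = complex_of_real l *s b)" for B :: "(complex ^ 'n) set"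
  have "P {}" by (simp add: P_def corthonormal_def)
  moreover have "\<forall>B. P B \<longrightarrow> card B \<le> DIM(complex ^ 'n)"
    using corthonormal_finite_card by (auto simp: P_def)
  ultimately obtain B where B: "P B" "\<And>C. P C \<Longrightarrow> card C \<le> card B"
    using ex_has_greatest_nat[of P "{}" card "Suc (DIM(complex ^ 'n))"] less_Suc_eq_le by metis
  have fin: "finite B" and on: "corthonormal B"
    using B corthonormal_finite_card by (auto simp: P_def)
  have expand: "(\<Sum>b\<in>B. cinner b x *s b) = x" for x
  proof (rule ccontr)
    \<comment> \<open>The part of \<open>x\<close> orthogonal to \<open>B\<close>, which witnesses a
      nonzero complement.\<close>
    define y where "y = x - (\<Sum>b\<in>B. cinner b x *s b)"
    assume "(\<Sum>b\<in>B. cinner b x *s b) \<noteq> x"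
    then have "y \<noteq> 0" by (simp add: y_def)
    moreover have "cinner a y = 0" if "a \<in> B" for a
    proof -
      have "cinner a (\<Sum>b\<in>B. cinner b x *s b) = (\<Sum>b\<in>B. if b = a then cinner b x else 0)"
        unfolding cinner_sum_right
        using on that by (intro sum.cong) (auto simp: corthonormal_def cinner_scale_right)
      also have "\<dots> = cinner a x" using that fin by simp
      finally show ?thesis by (simp add: y_def cinner_diff_right)
    qed
    ultimately obtain v m where v: "norm v = 1" "\<And>b. b \<in> B \<Longrightarrow> cinner b v = 0"
      "A *v v = complex_of_real m *s v"
      using hermitian_eigenvector_in_complement[OF herm, of B y] B(1) by (metis P_def)
    have vv: "cinner v v = 1" using v by (simp add: cinner_self)
    then have "v \<notin> B" using v(2) by force
    have "cinner v b = 0" if "b \<in> B" for b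
      using v(2)[OF that] cnj_cinner[of b v] by simp
    then have "P (insert v B)"
      using B(1) v vv \<open>v \<notin> B\<close> by (auto simp: P_def corthonormal_def)
    then show False using B(2)[of "insert v B"] fin \<open>v \<notin> B\<close> by simp
  qed
  obtain l where "\<And>b. b \<in> B \<Longrightarrow> A *v b = complex_of_real (l b) *s b"
    using B(1) unfolding P_def by metis
  then show ?thesis using that fin on expand by blast
qed

lemma matrix_sum: "A *v (\<Sum>b\<in>B. f b) = (\<Sum>b\<in>B. A *v (f b :: complex ^ 'n::finite))"
  by (induction B rule: infinite_finite_induct) (simp_all add: matrix_vector_right_distrib)

text \<open>Expanding \<open>axis k 1\<close> along \<open>B\<close> inside the diagonal entry at
  \<open>k\<close> and then summing over \<open>k\<close> moves the trace from the standard basis to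
  \<open>B\<close>.\<close>

lemma trace_orthonormal_expansion:
  fixes M :: "'n::finite op"
  assumes expand: "\<And>x. (\<Sum>b\<in>B. cinner b x *s b) = x"
  shows "trace M = (\<Sum>b\<in>B. cinner b (M *v b))"
proof -
  have "M $ k $ k = (\<Sum>b\<in>B. cnj (b $ k) * (M *v b) $ k)" for k
  proof -
    have "M $ k $ k = (M *v axis k 1) $ k"
      by (simp add: matrix_vector_mult_def axis_def if_distrib cong: if_cong)
    also have "\<dots> = (\<Sum>b\<in>B. cinner b (axis k 1) * (M *v b) $ k)"
      by (subst expand[of "axis k 1", symmetric]) (simp add: matrix_sum matrix_scale sum_component)
    also have "\<dots> = (\<Sum>b\<in>B. cnj (b $ k) * (M *v b) $ k)"
      by (simp add: cinner_def axis_def if_distrib cong: if_cong)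
    finally show ?thesis .
  qed
  then show ?thesis
    by (simp add: trace_def cinner_def) (rule sum.swap)
qed

section \<open>Positive square roots and the trace norm\<close>

text \<open>Polarisation: the quadratic form is real, and testing it on \<open>u + v\<close> and
  \<open>u + \<i> *s v\<close> gives the imaginary and real parts of conjugate symmetry.\<close>

lemma psd_hermitian:
  fixes A :: "'n::finite op"
  assumes "psd A"
  shows "dagger A = A"
proof -
  have real: "Im (cinner v (A *v v)) = 0" for v
    using assms by (auto simp: psd_def complex_nonneg_Reals_iff)
  have sym: "cinner v (A *v u) = cnj (cinner u (A *v v))" for u v
  proof -
    have "Im (cinner (u + v) (A *v (u + v))) = 0" "Im (cinner (u + \<i> *s v) (A *v (u + \<i> *s v))) = 0"
      by (rule real)+
    then show ?thesis using real[of u] real[of v]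
      by (simp add: matrix_vector_right_distrib matrix_scale cinner_add_left cinner_add_right
        cinner_scale_left cinner_scale_right complex_eq_iff)
  qed
  have entry: "A $ i $ j = cinner (axis i 1) (A *v axis j 1)" for i j
    by (simp add: cinner_def matrix_vector_mult_def axis_def if_distrib if_distribR cong: if_cong)
  have "dagger A $ i $ j = A $ i $ j" for i j
    using sym[of "axis i 1" "axis j 1"] by (simp add: dagger_def flip: entry)
  then show ?thesis by (simp add: vec_eq_iff)
qed

text \<open>The hypothesis factors as (R + l)(R - l) b = 0, so (R - l) b would be an eigenvector for
  the value -l, which positivity excludes unless it vanishes or l = 0. For l = 0 the squared norm of
  R b is the inner product of b with R R b, which is zero.\<close>

lemma psd_eigenvector_of_square:
  fixes R :: "'n::finite op"
  assumes R: "psd R" and l: "l \<ge> 0" and sq: "R *v (R *v b) = complex_of_real (l\<^sup>2) *s b"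
  shows "R *v b = complex_of_real l *s b"
proof -
  define w where "w = R *v b - complex_of_real l *s b"
  have "R *v w = complex_of_real (- l) *s w"
    by (simp add: w_def matrix_vector_mult_diff_distrib matrix_scale sq)
      (simp add: vec_eq_iff power2_eq_square algebra_simps)
  then have "cinner w (R *v w) = complex_of_real (- l * (norm w)\<^sup>2)"
    by (simp only: cinner_scale_right cinner_self of_real_mult)
  moreover have "cinner w (R *v w) \<in> \<real>\<^sub>\<ge>\<^sub>0" using R by (simp add: psd_def)
  ultimately have "0 \<le> - l * (norm w)\<^sup>2"
    by (simp only: nonneg_Reals_of_real_iff)
  then have "l * (norm w)\<^sup>2 \<le> 0" by simp
  then consider "w = 0" | "l = 0" using l
    by (auto simp: mult_le_0_iff)
  then show ?thesis
  proof cases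
    case 1 then show ?thesis by (simp add: w_def)
  next
    case 2
    have "cinner (R *v b) (R *v b) = cinner b (R *v (R *v b))"
      by (simp add: cinner_matrix[of b R] psd_hermitian[OF R])
    then have "cinner (R *v b) (R *v b) = 0" using 2 by (simp add: sq)
    then show ?thesis using 2 by (simp add: cinner_self_eq_0_iff)
  qed
qed

text \<open>Makes the definite description in \<open>psd_sqrt\<close> meaningful. On an eigenbasis
  of \<open>S\<close> the square of \<open>R\<close> acts as the square of a nonnegative eigenvalue,
  which forces \<open>R\<close> to act as that eigenvalue.\<close>

lemma psd_square_root_unique:
  fixes R S :: "'n::finite op"
  assumes R: "psd R" and S: "psd S" and eq: "R ** R = S ** S"
  shows "R = S"
proof -
  obtain B l where B: "finite B" "corthonormal B"
    "\<And>b. b \<in> B \<Longrightarrow> S *v b = complex_of_real (l b) *s b"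
    "\<And>x. (\<Sum>b\<in>B. cinner b x *s b) = x"
    using hermitian_eigenbasis[OF psd_hermitian[OF S]] by blast
  have ev: "R *v b = S *v b" if b: "b \<in> B" for b
  proof -
    have "cinner b (S *v b) = complex_of_real (l b)"
      using B(2,3) b by (auto simp: corthonormal_def cinner_scale_right)
    then have "complex_of_real (l b) \<in> \<real>\<^sub>\<ge>\<^sub>0" using S by (metis psd_def)
    then have "l b \<ge> 0" by simp
    moreover have "R *v (R *v b) = complex_of_real ((l b)\<^sup>2) *s b"
      unfolding matrix_vector_mul_assoc eq
      unfolding matrix_vector_mul_assoc[symmetric] B(3)[OF b] matrix_scale
      by (simp add: vec_eq_iff power2_eq_square)
    ultimately show ?thesis using psd_eigenvector_of_square[OF R] B(3)[OF b] by simp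
  qed
  have "R *v (\<Sum>b\<in>B. cinner b x *s b) = S *v (\<Sum>b\<in>B. cinner b x *s b)" for x
    by (simp add: matrix_sum matrix_scale ev)
  then have "R *v x = S *v x" for x
    unfolding B(4) .
  then show ?thesis by (simp add: matrix_eq)
qed

lemma psd_sqrt_eqI: "psd R \<Longrightarrow> R ** R = A \<Longrightarrow> psd_sqrt A = R"
  unfolding psd_sqrt_def by (rule the_equality) (auto intro: psd_square_root_unique)

text \<open>In an eigenbasis the trace norm is the sum of the moduli of the eigenvalues. The same
  \<open>B\<close> also computes every trace, so that trace norm and traces can be compared term by
  term.\<close>

lemma trace_norm_hermitian:
  fixes X :: "'n::finite op"
  assumes herm: "dagger X = X"
  obtains B where "trace_norm X = (\<Sum>b\<in>B. norm (cinner b (X *v b)))"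
    "\<And>M. trace M = (\<Sum>b\<in>B. cinner b (M *v b))"
proof -
  obtain B l where B: "finite B" "corthonormal B"
    "\<And>b. b \<in> B \<Longrightarrow> X *v b = complex_of_real (l b) *s b"
    "\<And>x. (\<Sum>b\<in>B. cinner b x *s b) = x"
    using hermitian_eigenbasis[OF herm] by blast
  \<comment> \<open>The operator absolute value of \<open>X\<close>: the same eigenvectors, with the
    eigenvalues replaced by their absolute values.\<close>
  define R :: "'n op" where "R = (\<chi> i j. \<Sum>b\<in>B. complex_of_real \<bar>l b\<bar> * b $ i * cnj (b $ j))"
  have Rv: "R *v v = (\<Sum>b\<in>B. (complex_of_real \<bar>l b\<bar> * cinner b v) *s b)" for v
  proof -
    have "(R *v v) $ i = (\<Sum>j\<in>UNIV. \<Sum>b\<in>B. complex_of_real \<bar>l b\<bar> * b $ i * cnj (b $ j) * v $ j)" for i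
      by (simp add: R_def matrix_vector_mult_def sum_distrib_right)
    also have "\<dots> i = (\<Sum>b\<in>B. \<Sum>j\<in>UNIV. complex_of_real \<bar>l b\<bar> * b $ i * cnj (b $ j) * v $ j)" for i
      by (rule sum.swap)
    finally show ?thesis
      by (simp add: vec_eq_iff sum_component cinner_def sum_distrib_left mult_ac)
  qed
  have Rb: "R *v b = complex_of_real \<bar>l b\<bar> *s b" if b: "b \<in> B" for b
  proof -
    have "R *v b = (\<Sum>a\<in>B. if a = b then complex_of_real \<bar>l b\<bar> *s b else 0)"
      unfolding Rv using B(2) b by (intro sum.cong) (auto simp: corthonormal_def)
    then show ?thesis using b B(1) by simp
  qed
  have "psd R"
  proof -
    have "cinner v (R *v v) = complex_of_real (\<Sum>b\<in>B. \<bar>l b\<bar> * (norm (cinner b v))\<^sup>2)" for v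
      unfolding Rv cinner_sum_right cinner_scale_right
      by (simp add: cnj_cinner[of _ v, symmetric] complex_norm_square mult.assoc del: of_real_power)
    moreover have "0 \<le> (\<Sum>b\<in>B. \<bar>l b\<bar> * (norm (cinner b v))\<^sup>2)" for v
      by (intro sum_nonneg) auto
    ultimately show ?thesis by (simp only: psd_def nonneg_Reals_of_real_iff) simp
  qed
  moreover have "R ** R = dagger X ** X"
  proof -
    have "R *v (R *v b) = X *v (X *v b)" if "b \<in> B" for b
      using that by (simp add: Rb B(3) matrix_scale vector_smult_assoc flip: of_real_mult)
    then have "R *v (R *v (\<Sum>b\<in>B. cinner b x *s b)) = X *v (X *v (\<Sum>b\<in>B. cinner b x *s b))" for x
      by (simp add: matrix_sum matrix_scale)
    then have "R *v (R *v x) = X *v (X *v x)" for x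
      unfolding B(4) .
    then show ?thesis by (simp add: matrix_eq herm flip: matrix_vector_mul_assoc)
  qed
  ultimately have "psd_sqrt (dagger X ** X) = R" by (rule psd_sqrt_eqI)
  then have "trace_norm X = Re (\<Sum>b\<in>B. cinner b (R *v b))"
    unfolding trace_norm_def by (subst trace_orthonormal_expansion[OF B(4), symmetric]) simp
  also have "\<dots> = (\<Sum>b\<in>B. norm (cinner b (X *v b)))"
    unfolding Re_sum using B(2)
    by (intro sum.cong) (auto simp: Rb B(3) cinner_scale_right corthonormal_def)
  finally show ?thesis using that trace_orthonormal_expansion[OF B(4)] by blast
qed

lemma dagger_diff: "dagger (A - B) = dagger A - dagger B"
  by (simp add: dagger_def vec_eq_iff)

text \<open>The triangle inequality is applied to each diagonal term in an eigenbasis of the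
  difference; for positive operators those terms equal their moduli and add up to the
  traces.\<close>

lemma trace_norm_diff_psd_le:
  fixes P Q :: "'n::finite op"
  assumes P: "psd P" and Q: "psd Q"
  shows "trace_norm (P - Q) \<le> Re (trace P) + Re (trace Q)"
proof -
  have "dagger (P - Q) = P - Q"
    by (simp add: dagger_diff psd_hermitian P Q)
  then obtain B where B: "trace_norm (P - Q) = (\<Sum>b\<in>B. norm (cinner b ((P - Q) *v b)))"
    and tr: "\<And>M. trace M = (\<Sum>b\<in>B. cinner b (M *v b))"
    using trace_norm_hermitian by blast
  have nn: "norm (cinner b (M *v b)) = Re (cinner b (M *v b))" if "psd M" for M b
    using that by (auto simp: psd_def complex_nonneg_Reals_iff cmod_eq_Re)
  have "norm (cinner b ((P - Q) *v b)) \<le> Re (cinner b (P *v b)) + Re (cinner b (Q *v b))" for b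
    using norm_triangle_ineq4[of "cinner b (P *v b)" "cinner b (Q *v b)"]
    by (simp add: matrix_vector_mult_diff_rdistrib cinner_diff_right nn P Q)
  then show ?thesis unfolding B tr Re_sum sum.distrib[symmetric]
    by (intro sum_mono)
qed

lemma psd_add: "psd P \<Longrightarrow> psd Q \<Longrightarrow> psd (P + Q)"
  by (simp add: psd_def matrix_vector_mult_add_rdistrib cinner_add_right nonneg_Reals_add_I)

lemma dagger_mult: "dagger (A ** B) = dagger B ** dagger A"
  by (simp add: dagger_def vec_eq_iff matrix_matrix_mult_def mult.commute)

lemma matrix_mult_distribs:
  fixes A B C :: "'n::finite op"
  shows "A ** (B + C) = A ** B + A ** C" "(A + B) ** C = A ** C + B ** C"
    "A ** (B - C) = A ** B - A ** C" "(A - B) ** C = A ** C - B ** C"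
  by (simp_all add: vec_eq_iff matrix_matrix_mult_def algebra_simps sum.distrib sum_subtractf)

text \<open>Taking adjoints gives Q P = 0 as well, so all cross terms vanish, P - Q and P + Q have
  the same square, and P + Q is its positive root.\<close>

lemma trace_norm_diff_orthogonal:
  fixes P Q :: "'n::finite op"
  assumes P: "psd P" and Q: "psd Q" and PQ: "P ** Q = 0"
  shows "trace_norm (P - Q) = Re (trace P) + Re (trace Q)"
proof -
  have h: "dagger P = P" "dagger Q = Q" using P Q psd_hermitian by auto
  have "Q ** P = dagger (P ** Q)" by (simp add: dagger_mult h)
  then have QP: "Q ** P = 0" by (simp add: PQ dagger_def vec_eq_iff)
  have "(P + Q) ** (P + Q) = dagger (P - Q) ** (P - Q)"
    by (simp add: dagger_diff h matrix_mult_distribs PQ QP)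
  then have "psd_sqrt (dagger (P - Q) ** (P - Q)) = P + Q"
    by (intro psd_sqrt_eqI psd_add P Q)
  then show ?thesis by (simp add: trace_norm_def trace_add)
qed

section \<open>The maps compared by the causal influence\<close>

lemma sum_double_delta:
  "(\<Sum>i\<in>UNIV. \<Sum>j\<in>UNIV. if i = a \<and> j = b then f i j else 0) = f a b"
  for f :: "'x::finite \<Rightarrow> 'y::finite \<Rightarrow> 'z::comm_monoid_add"
proof -
  have "(\<Sum>j\<in>UNIV. if i = a \<and> j = b then f i j else 0) = (if i = a then f i b else 0)" for i
    by (cases "i = a") simp_all
  then show ?thesis by simp
qed

lemma tensor_map_nth:
  "tensor_map L M X $ p $ q = (\<Sum>i\<in>UNIV. \<Sum>j\<in>UNIV. \<Sum>k\<in>UNIV. \<Sum>l\<in>UNIV.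
    X $ (i, k) $ (j, l) * (L (unit_op i j) $ fst p $ fst q * M (unit_op k l) $ snd p $ snd q))"
  by (simp add: tensor_map_def cscale_def tensor_op_def)

lemma unit_op_nth: "unit_op i j $ k $ l = (if i = k \<and> j = l then 1 else 0)"
  by (auto simp: unit_op_def)

text \<open>Linearity reassembles the matrix units: with \<open>id\<close> on the left factor,
  \<open>L\<close> acts separately on each block of \<open>X\<close>.\<close>

lemma tensor_map_id_left_nth:
  assumes "clinear_map L"
  shows "tensor_map id L X $ p $ q
    = L (\<chi> k l. X $ (fst p, k) $ (fst q, l)) $ snd p $ snd q"
proof -
  have "tensor_map id L X $ p $ q = (\<Sum>i\<in>UNIV. \<Sum>j\<in>UNIV. if i = fst p \<and> j = fst q then
      \<Sum>k\<in>UNIV. \<Sum>l\<in>UNIV. X $ (i, k) $ (j, l) * L (unit_op k l) $ snd p $ snd q else 0)"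
    unfolding tensor_map_nth by (intro sum.cong refl) (simp add: unit_op_nth)
  also have "\<dots> = L (\<chi> k l. X $ (fst p, k) $ (fst q, l)) $ snd p $ snd q"
    unfolding sum_double_delta by (subst clinear_map_expand[OF assms]) (simp add: cscale_def)
  finally show ?thesis .
qed

lemma tensor_map_id_right_nth:
  assumes "clinear_map L"
  shows "tensor_map L id X $ p $ q
    = L (\<chi> i j. X $ (i, snd p) $ (j, snd q)) $ fst p $ fst q"
proof -
  have "tensor_map L id X $ p $ q = (\<Sum>i\<in>UNIV. \<Sum>j\<in>UNIV. \<Sum>k\<in>UNIV. \<Sum>l\<in>UNIV.
      if k = snd p \<and> l = snd q then X $ (i, k) $ (j, l) * L (unit_op i j) $ fst p $ fst q else 0)"
    unfolding tensor_map_nth by (intro sum.cong refl) (simp add: unit_op_nth)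
  also have "\<dots> = L (\<chi> i j. X $ (i, snd p) $ (j, snd q)) $ fst p $ fst q"
    unfolding sum_double_delta by (subst clinear_map_expand[OF assms]) (simp add: cscale_def)
  finally show ?thesis .
qed

lemma clinear_mapI:
  assumes "\<And>A B. L (A + B) = L A + L B" "\<And>c A. L (cscale c A) = cscale c (L A)"
  shows "clinear_map L"
  using assms
  by (simp add: Vector_Spaces.linear_def module_hom_def module_hom_axioms_def
      module_iff_vector_space vector_space_cscale)

lemma clinear_map_add: "clinear_map L \<Longrightarrow> L (A + B) = L A + L B"
  and clinear_map_cscale: "clinear_map L \<Longrightarrow> L (cscale c A) = cscale c (L A)"
  by (simp_all add: Vector_Spaces.linear_def module_hom_def module_hom_axioms_def)

lemma clinear_map_zero: "clinear_map L \<Longrightarrow> L 0 = 0"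
  using clinear_map_add[of L 0 0] by simp

lemma clinear_map_id: "clinear_map id"
  by (rule clinear_mapI) simp_all

text \<open>Lets the diamond norm of a difference of maps be read as a supremum of trace distances
  between their outputs.\<close>

lemma tensor_map_diff_right:
  "tensor_map L (\<lambda>\<rho>. M \<rho> - N \<rho>) X = tensor_map L M X - tensor_map L N X"
  by (simp add: vec_eq_iff tensor_map_nth algebra_simps sum_subtractf)

lemma mult_swap_gate_nth: "(Y ** swap_gate) $ p $ q = Y $ p $ prod.swap q"
  by (simp add: matrix_matrix_mult_def swap_gate_def if_distrib[of "\<lambda>x. c * x" for c] cong: if_cong)

lemma swap_gate_mult_nth: "(swap_gate ** Y) $ p $ q = Y $ prod.swap p $ q"
  by (simp add: matrix_matrix_mult_def swap_gate_nth if_distrib[of "\<lambda>x. x * c" for c] cong: if_cong)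

lemma swap_channel_nth:
  "unitary_channel swap_gate X $ p $ q = X $ prod.swap p $ prod.swap q"
  by (simp add: unitary_channel_def dagger_swap_gate mult_swap_gate_nth swap_gate_mult_nth)

lemma clinear_map_swap_channel: "clinear_map (unitary_channel swap_gate)"
  by (rule clinear_mapI) (simp_all add: vec_eq_iff swap_channel_nth cscale_def)

text \<open>The inverse SWAP reorders A'B' = BA into AB, the two copies of A are exchanged, and SWAP
  restores the order. The net effect exchanges the first and third indices.\<close>

lemma swap_conjugate_swap_channel_nth:
  fixes X :: "('a::finite \<times> 'b::finite \<times> 'a) op"
  shows "swap_conjugate (unitary_channel (swap_gate :: complex ^ ('a \<times> 'b) ^ ('b \<times> 'a))) X
    $ (a, b, c) $ (a', b', c') = X $ (c, b, a) $ (c', b', a')"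
  by (simp add: swap_conjugate_def inv_unitary_channel unitary_swap_gate dagger_swap_gate
      tensor_map_id_left_nth tensor_map_id_right_nth clinear_map_swap_channel swap_channel_nth
      assoc_left_def assoc_right_def)

section \<open>Density operators under channels acting on part of a system\<close>

lemma completely_positive_blocks:
  fixes X :: "'k::finite \<Rightarrow> 'k \<Rightarrow> 'x::finite op" and C :: "'x op \<Rightarrow> 'y::finite op"
  assumes C: "completely_positive C"
    and X: "\<And>v. (\<Sum>i\<in>UNIV. \<Sum>j\<in>UNIV. cinner (v i) (X i j *v v j)) \<in> \<real>\<^sub>\<ge>\<^sub>0"
  shows "(\<Sum>i\<in>UNIV. \<Sum>j\<in>UNIV. cinner (v i) (C (X i j) *v v j)) \<in> \<real>\<^sub>\<ge>\<^sub>0"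
proof -
  \<comment> \<open>Complete positivity is stated for blocks numbered by naturals, so the finite
    index type is enumerated by \<open>h\<close>; its inverse \<open>g\<close> carries test vectors
    back.\<close>
  obtain h where h: "bij_betw h {..<CARD('k)} (UNIV :: 'k set)"
    using ex_bij_betw_nat_finite[of "UNIV :: 'k set"] by (auto simp: atLeast0LessThan)
  have reindex: "(\<Sum>i<CARD('k). \<Sum>j<CARD('k). f (h i) (h j)) = (\<Sum>i\<in>UNIV. \<Sum>j\<in>UNIV. f i j)"
    for f :: "'k \<Rightarrow> 'k \<Rightarrow> complex"
  proof -
    have "(\<Sum>i<CARD('k). \<Sum>j<CARD('k). f (h i) (h j)) = (\<Sum>i<CARD('k). \<Sum>j\<in>UNIV. f (h i) j)"
      by (rule sum.cong[OF refl], rule sum.reindex_bij_betw[OF h])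
    also have "\<dots> = (\<Sum>i\<in>UNIV. \<Sum>j\<in>UNIV. f i j)"
      by (rule sum.reindex_bij_betw[OF h])
    finally show ?thesis .
  qed
  define g where "g = inv_into {..<CARD('k)} h"
  have gh: "g (h i) = i" if "i < CARD('k)" for i
    unfolding g_def using h that by (simp add: bij_betw_inv_into_left)
  have "block_psd (CARD('k)) (\<lambda>i j. X (h i) (h j))"
    unfolding block_psd_def
  proof
    fix w :: "nat \<Rightarrow> complex ^ 'x"
    have "(\<Sum>i<CARD('k). \<Sum>j<CARD('k). cinner (w i) (X (h i) (h j) *v w j))
        = (\<Sum>i<CARD('k). \<Sum>j<CARD('k). cinner (w (g (h i))) (X (h i) (h j) *v w (g (h j))))"
      by (intro sum.cong refl) (simp add: gh)
    also have "\<dots> = (\<Sum>i\<in>UNIV. \<Sum>j\<in>UNIV. cinner (w (g i)) (X i j *v w (g j)))"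
      by (rule reindex)
    finally show "(\<Sum>i<CARD('k). \<Sum>j<CARD('k). cinner (w i) (X (h i) (h j) *v w j)) \<in> \<real>\<^sub>\<ge>\<^sub>0"
      using X[of "\<lambda>k. w (g k)"] by simp
  qed
  then have "block_psd (CARD('k)) (\<lambda>i j. C (X (h i) (h j)))"
    using C unfolding completely_positive_def by blast
  then have "(\<Sum>i<CARD('k). \<Sum>j<CARD('k). cinner (v (h i)) (C (X (h i) (h j)) *v v (h j))) \<in> \<real>\<^sub>\<ge>\<^sub>0"
    unfolding block_psd_def by (rule allE[of _ "\<lambda>i. v (h i)"])
  then show ?thesis
    unfolding reindex[of "\<lambda>i j. cinner (v i) (C (X i j) *v v j)"] .
qed

lemma psd_iff_entries:
  "psd A \<longleftrightarrow> (\<forall>v. (\<Sum>p\<in>UNIV. \<Sum>q\<in>UNIV. cnj (v $ p) * A $ p $ q * v $ q) \<in> \<real>\<^sub>\<ge>\<^sub>0)"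
  by (simp add: psd_def cinner_def matrix_vector_mult_def sum_distrib_left mult.assoc)

text \<open>Relabelling the basis along a bijection only permutes the entries of the test
  vectors.\<close>

lemma psd_reindex:
  fixes A :: "'x::finite op" and f :: "'y::finite \<Rightarrow> 'x"
  assumes A: "psd A" and f: "bij f" and B: "\<And>p q. B $ p $ q = A $ f p $ f q"
  shows "psd B"
  unfolding psd_iff_entries
proof
  fix v :: "complex ^ 'y"
  define w where "w = (\<chi> p. v $ inv f p)"
  have "v $ p = w $ f p" for p using f by (simp add: w_def bij_is_inj)
  then have "(\<Sum>p\<in>UNIV. \<Sum>q\<in>UNIV. cnj (v $ p) * B $ p $ q * v $ q)
      = (\<Sum>p\<in>UNIV. \<Sum>q\<in>UNIV. cnj (w $ f p) * A $ f p $ f q * w $ f q)"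
    by (simp add: B)
  also have "\<dots> = (\<Sum>p\<in>UNIV. \<Sum>q\<in>UNIV. cnj (w $ f p) * A $ f p $ q * w $ q)"
    by (rule sum.cong[OF refl], rule sum.reindex_bij_betw[OF f])
  also have "\<dots> = (\<Sum>p\<in>UNIV. \<Sum>q\<in>UNIV. cnj (w $ p) * A $ p $ q * w $ q)"
    by (rule sum.reindex_bij_betw[OF f])
  also have "\<dots> \<in> \<real>\<^sub>\<ge>\<^sub>0" using A unfolding psd_iff_entries by blast
  finally show "(\<Sum>p\<in>UNIV. \<Sum>q\<in>UNIV. cnj (v $ p) * B $ p $ q * v $ q) \<in> \<real>\<^sub>\<ge>\<^sub>0" .
qed

lemma sum_UNIV_prod: "(\<Sum>p\<in>UNIV. g p) = (\<Sum>i\<in>UNIV. \<Sum>k\<in>UNIV. g (i, k))"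
  for g :: "'x::finite \<times> 'y::finite \<Rightarrow> 'z::comm_monoid_add"
  by (simp add: sum.cartesian_product)

lemma psd_tensor_map_id:
  fixes C :: "'x::finite op \<Rightarrow> 'y::finite op" and A :: "('k::finite \<times> 'x) op"
  assumes C: "clinear_map C" "completely_positive C" and A: "psd A"
  shows "psd (tensor_map id C A)"
proof -
  \<comment> \<open>Identifies positivity on the composite system with the block form used in the
    definition of complete positivity.\<close>
  have blocks: "(\<Sum>p\<in>UNIV. \<Sum>q\<in>UNIV. cnj (v $ p) * B $ p $ q * v $ q)
      = (\<Sum>i\<in>UNIV. \<Sum>j\<in>UNIV. cinner (\<chi> k. v $ (i, k)) ((\<chi> k l. B $ (i, k) $ (j, l)) *v (\<chi> l. v $ (j, l))))"
    for B :: "('k \<times> 'z::finite) op" and v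
  proof -
    have "(\<Sum>p\<in>UNIV. \<Sum>q\<in>UNIV. cnj (v $ p) * B $ p $ q * v $ q)
      = (\<Sum>i\<in>UNIV. \<Sum>k\<in>UNIV. \<Sum>j\<in>UNIV. \<Sum>l\<in>UNIV. cnj (v $ (i, k)) * B $ (i, k) $ (j, l) * v $ (j, l))"
      by (simp only: sum_UNIV_prod)
    also have "\<dots> = (\<Sum>i\<in>UNIV. \<Sum>j\<in>UNIV. \<Sum>k\<in>UNIV. \<Sum>l\<in>UNIV. cnj (v $ (i, k)) * B $ (i, k) $ (j, l) * v $ (j, l))"
      by (intro sum.cong refl sum.swap)
    finally show ?thesis
      by (simp add: cinner_def matrix_vector_mult_def sum_distrib_left mult.assoc)
  qed
  let ?X = "\<lambda>i j. \<chi> k l. A $ (i, k) $ (j, l)"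
  have "(\<Sum>i\<in>UNIV. \<Sum>j\<in>UNIV. cinner (w i) (?X i j *v w j)) \<in> \<real>\<^sub>\<ge>\<^sub>0" for w
    using A[unfolded psd_iff_entries, rule_format, of "\<chi> p. w (fst p) $ snd p"]
    by (subst (asm) blocks) (simp add: vec_lambda_eta)
  then have "(\<Sum>i\<in>UNIV. \<Sum>j\<in>UNIV. cinner (w i) (C (?X i j) *v w j)) \<in> \<real>\<^sub>\<ge>\<^sub>0" for w
    by (rule completely_positive_blocks[OF C(2)])
  then show ?thesis
    unfolding psd_iff_entries blocks by (simp add: tensor_map_id_left_nth[OF C(1)])
qed

lemma trace_tensor_map_id:
  fixes C :: "'x::finite op \<Rightarrow> 'y::finite op" and A :: "('k::finite \<times> 'x) op"
  assumes C: "clinear_map C" "\<And>X. trace (C X) = trace X"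
  shows "trace (tensor_map id C A) = trace A"
proof -
  have tr: "trace B = (\<Sum>i\<in>UNIV. trace (\<chi> k l. B $ (i, k) $ (i, l)))" for B :: "('k \<times> 'z::finite) op"
    by (simp add: trace_def sum_UNIV_prod)
  have "(\<chi> k l. tensor_map id C A $ (i, k) $ (i, l)) = C (\<chi> k l. A $ (i, k) $ (i, l))" for i
    by (simp add: vec_eq_iff tensor_map_id_left_nth[OF C(1)])
  then show ?thesis by (simp add: tr C(2))
qed

lemma clinear_map_comp:
  assumes "clinear_map L" "clinear_map M"
  shows "clinear_map (L \<circ> M)"
  using assms by (intro clinear_mapI) (simp_all add: clinear_map_add clinear_map_cscale)

lemma clinear_map_tensor_map: "clinear_map (tensor_map L M)"
  by (rule clinear_mapI)
    (simp_all add: vec_eq_iff tensor_map_nth cscale_def algebra_simps sum.distrib sum_distrib_left)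

lemma clinear_map_assoc: "clinear_map assoc_left" "clinear_map assoc_right"
  by (rule clinear_mapI; simp add: vec_eq_iff assoc_left_def assoc_right_def cscale_def)+

text \<open>The competitor C \<otimes> I on AA'B' in the definition of causal influence.\<close>

abbreviation extend_map ::
  "(('a::finite \<times> 'c::finite) op \<Rightarrow> ('a \<times> 'c) op) \<Rightarrow> ('a \<times> 'c \<times> 'd::finite) op \<Rightarrow> ('a \<times> 'c \<times> 'd) op"
  where "extend_map C \<equiv> assoc_right \<circ> tensor_map C id \<circ> assoc_left"

lemma tensor_map_id_extend_map_nth:
  fixes X :: "('e::finite \<times> 'a::finite \<times> 'c::finite \<times> 'd::finite) op"
  assumes "clinear_map C"
  shows "tensor_map id (extend_map C) X $ (e, a, c, d) $ (e', a', c', d')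
    = C (\<chi> p q. X $ (e, fst p, snd p, d) $ (e', fst q, snd q, d')) $ (a, c) $ (a', c')"
proof -
  have "clinear_map (extend_map C :: ('a \<times> 'c \<times> 'd) op \<Rightarrow> _)"
    by (intro clinear_map_comp clinear_map_assoc clinear_map_tensor_map)
  then show ?thesis
    by (simp add: tensor_map_id_left_nth)
      (simp add: assoc_right_def assoc_left_def tensor_map_id_right_nth[OF assms])
qed

lemma tensor_map_id_swap_conjugate_nth:
  fixes X :: "('e::finite \<times> 'a::finite \<times> 'b::finite \<times> 'a) op"
  shows "tensor_map id (swap_conjugate (unitary_channel
      (swap_gate :: complex ^ ('a \<times> 'b) ^ ('b \<times> 'a)))) X $ (e, a, b, c) $ (e', a', b', c')
    = X $ (e, c, b, a) $ (e', c', b', a')"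
proof -
  have "clinear_map (swap_conjugate (unitary_channel
      (swap_gate :: complex ^ ('a \<times> 'b) ^ ('b \<times> 'a))))"
    by (rule clinear_mapI) (simp_all add: vec_eq_iff cscale_def swap_conjugate_swap_channel_nth)
  then show ?thesis
    by (simp add: tensor_map_id_left_nth swap_conjugate_swap_channel_nth)
qed

lemma trace_reindex:
  fixes A :: "'x::finite op" and f :: "'y::finite \<Rightarrow> 'x"
  assumes f: "bij f" and B: "\<And>p q. B $ p $ q = A $ f p $ f q"
  shows "trace B = trace A"
  unfolding trace_def B by (rule sum.reindex_bij_betw[OF f])

lemma density_reindex:
  fixes A :: "'x::finite op" and f :: "'y::finite \<Rightarrow> 'x"
  assumes "A \<in> density" and "bij f" and "\<And>p q. B $ p $ q = A $ f p $ f q"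
  shows "B \<in> density"
  using assms psd_reindex[of A f B] trace_reindex[of f B A] by (simp add: density_def)

lemma density_tensor_map_id:
  assumes "C \<in> channels" "A \<in> density"
  shows "tensor_map id C A \<in> density"
  using assms by (simp add: density_def channels_def psd_tensor_map_id trace_tensor_map_id)

text \<open>Up to a permutation of factors, C with identities on E and on B' is C with a single
  identity on the joint reference system, to which complete positivity applies.\<close>

lemma density_extend_map:
  fixes C :: "('a::finite \<times> 'c::finite) op \<Rightarrow> ('a \<times> 'c) op"
    and \<rho> :: "('e::finite \<times> 'a \<times> 'c \<times> 'd::finite) op"
  assumes C: "C \<in> channels" and \<rho>: "\<rho> \<in> density"
  shows "tensor_map id (extend_map C) \<rho> \<in> density"
proof -
  \<comment> \<open>\<open>f\<close> and its inverse \<open>g\<close> group the spectator indices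
    \<open>e\<close> and \<open>d\<close> into one reference index.\<close>
  define f :: "('e \<times> 'd) \<times> ('a \<times> 'c) \<Rightarrow> 'e \<times> 'a \<times> 'c \<times> 'd"
    where "f = (\<lambda>((e, d), (a, c)). (e, a, c, d))"
  define g :: "'e \<times> 'a \<times> 'c \<times> 'd \<Rightarrow> ('e \<times> 'd) \<times> ('a \<times> 'c)"
    where "g = (\<lambda>(e, a, c, d). ((e, d), (a, c)))"
  have f: "bij f" and g: "bij g"
    by (rule o_bij[of g] o_bij[of f]; auto simp: f_def g_def)+
  define \<sigma> where "\<sigma> = (\<chi> p q. \<rho> $ f p $ f q)"
  have "\<sigma> \<in> density" by (rule density_reindex[OF \<rho> f]) (simp add: \<sigma>_def)
  then have \<tau>: "tensor_map id C \<sigma> \<in> density" by (rule density_tensor_map_id[OF C])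
  have lin: "clinear_map C" using C by (simp add: channels_def)
  have "tensor_map id (extend_map C) \<rho> $ p $ q = tensor_map id C \<sigma> $ g p $ g q" for p q
    by (cases p; cases q)
      (simp add: tensor_map_id_extend_map_nth[OF lin] tensor_map_id_left_nth[OF lin] \<sigma>_def f_def g_def
        case_prod_beta)
  then show ?thesis by (rule density_reindex[OF \<tau> g])
qed

lemma density_swap_conjugate:
  fixes \<rho> :: "('e::finite \<times> 'a::finite \<times> 'b::finite \<times> 'a) op"
  assumes "\<rho> \<in> density"
  shows "tensor_map id (swap_conjugate (unitary_channel
      (swap_gate :: complex ^ ('a \<times> 'b) ^ ('b \<times> 'a)))) \<rho> \<in> density"
proof -
  define f :: "'e \<times> 'a \<times> 'b \<times> 'a \<Rightarrow> 'e \<times> 'a \<times> 'b \<times> 'a"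
    where "f = (\<lambda>(e, a, b, c). (e, c, b, a))"
  have "bij f" by (rule o_bij[of f]) (auto simp: f_def)
  then show ?thesis
    by (rule density_reindex[OF assms]) (auto simp: f_def tensor_map_id_swap_conjugate_nth)
qed

section \<open>The distinguishing basis state and the resulting diamond norm\<close>

lemma density_unit_op: "unit_op p p \<in> density"
proof -
  have "(\<Sum>i\<in>UNIV. \<Sum>j\<in>UNIV. cnj (v $ i) * unit_op p p $ i $ j * v $ j) = complex_of_real ((norm (v $ p))\<^sup>2)"
    for v :: "complex ^ 'a"
  proof -
    have "(\<Sum>i\<in>UNIV. \<Sum>j\<in>UNIV. cnj (v $ i) * unit_op p p $ i $ j * v $ j)
        = (\<Sum>i\<in>UNIV. \<Sum>j\<in>UNIV. if i = p \<and> j = p then cnj (v $ i) * v $ j else 0)"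
      by (intro sum.cong refl) (auto simp: unit_op_nth)
    then show ?thesis
      by (simp only: sum_double_delta) (simp add: complex_norm_square mult.commute del: of_real_power)
  qed
  then have "psd (unit_op p p)"
    unfolding psd_iff_entries by (simp del: of_real_power)
  moreover have "trace (unit_op p p) = 1"
    by (simp add: trace_def unit_op_nth)
  ultimately show ?thesis by (simp add: density_def)
qed

lemma unit_op_mult_eq_0:
  assumes "\<And>q. M $ p $ q = 0"
  shows "unit_op p p ** M = 0"
  using assms by (auto simp: vec_eq_iff matrix_matrix_mult_def unit_op_nth intro!: sum.neutral)

text \<open>Shows that the infimum in the causal influence ranges over a nonempty set.\<close>

lemma id_channel: "id \<in> channels"
  by (simp add: channels_def clinear_map_id completely_positive_def)

lemma diamond_norm_swap_conjugate:
  fixes C :: "('a::finite \<times> 'b::finite) op \<Rightarrow> ('a \<times> 'b) op"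
  assumes card: "CARD('a) \<ge> 2" and C: "C \<in> channels"
  shows "diamond_norm (\<lambda>\<rho>. swap_conjugate (unitary_channel
      (swap_gate :: complex ^ ('a \<times> 'b) ^ ('b \<times> 'a))) \<rho> - extend_map C \<rho>) = 2"
proof -
  let ?T = "swap_conjugate (unitary_channel (swap_gate :: complex ^ ('a \<times> 'b) ^ ('b \<times> 'a)))"
  let ?P = "tensor_map id ?T :: (('a \<times> 'b \<times> 'a) \<times> ('a \<times> 'b \<times> 'a)) op \<Rightarrow> _"
  let ?Q = "tensor_map id (extend_map C) :: (('a \<times> 'b \<times> 'a) \<times> ('a \<times> 'b \<times> 'a)) op \<Rightarrow> _"
  have P: "?P \<rho> \<in> density" and Q: "?Q \<rho> \<in> density" if "\<rho> \<in> density" for \<rho>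
    using that density_swap_conjugate density_extend_map[OF C] by blast+
  have le: "trace_norm (?P \<rho> - ?Q \<rho>) \<le> 2" if "\<rho> \<in> density" for \<rho>
    using trace_norm_diff_psd_le[of "?P \<rho>" "?Q \<rho>"] P[OF that] Q[OF that]
    by (simp add: density_def)
  \<comment> \<open>The dimension hypothesis enters here: for one-dimensional A, exchanging A with
    B' is the identity map and the influence is 0.\<close>
  obtain a b :: 'a where ab: "a \<noteq> b"
  proof -
    have "\<exists>a b :: 'a. a \<noteq> b"
    proof (rule ccontr)
      assume "\<nexists>a b :: 'a. a \<noteq> b"
      then have "(UNIV :: 'a set) = {undefined}" by auto
      then have "CARD('a) = 1" by (metis card.empty card_insert_disjoint empty_iff finite.emptyI One_nat_def)
      then show False using card by simp
    qed
    then show thesis using that by blast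
  qed
  \<comment> \<open>The reference system and A' are spectators, so any basis states serve for
    \<open>e\<close> and \<open>c\<close>.\<close>
  define e :: "'a \<times> 'b \<times> 'a" where "e = undefined"
  define c :: 'b where "c = undefined"
  let ?\<rho> = "unit_op (e, a, c, b) (e, a, c, b)"
  have \<rho>: "?\<rho> \<in> density" by (rule density_unit_op)
  have P\<rho>: "?P ?\<rho> = unit_op (e, b, c, a) (e, b, c, a)"
    by (auto simp: vec_eq_iff tensor_map_id_swap_conjugate_nth unit_op_nth)
  have lin: "clinear_map C" using C by (simp add: channels_def)
  have Q\<rho>: "?Q ?\<rho> $ (e, b, c, a) $ q = 0" for q
  proof (cases q)
    case (fields e' a' c' b')
    \<comment> \<open>B' is in state \<open>b\<close> in the input, so the block fed to
      \<open>C\<close> for the row index \<open>a\<close> of B' is zero, and linearity keeps it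
      zero.\<close>
    have "(\<chi> p q. ?\<rho> $ (e, fst p, snd p, a) $ (e', fst q, snd q, b')) = 0"
      using ab by (simp add: vec_eq_iff unit_op_nth)
    then show ?thesis
      by (simp add: fields tensor_map_id_extend_map_nth[OF lin] clinear_map_zero[OF lin])
  qed
  have "?P ?\<rho> ** ?Q ?\<rho> = 0"
    unfolding P\<rho> by (rule unit_op_mult_eq_0) (rule Q\<rho>)
  then have "trace_norm (?P ?\<rho> - ?Q ?\<rho>) = 2"
    using trace_norm_diff_orthogonal[of "?P ?\<rho>" "?Q ?\<rho>"] P[OF \<rho>] Q[OF \<rho>]
    by (simp add: density_def)
  \<comment> \<open>The upper bound 2 is attained, so the supremum is a maximum.\<close>
  then have "2 \<in> (\<lambda>\<rho>. trace_norm (?P \<rho> - ?Q \<rho>)) ` density"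
    using \<rho> by (metis (no_types, lifting) imageI)
  then show ?thesis
    unfolding diamond_norm_def tensor_map_diff_right
    by (rule cSup_eq_maximum) (use le in blast)
qed

theorem theorem3p1:
  assumes "CARD('a::finite) \<ge> 2"
  shows "causal_influence
    (unitary_channel (swap_gate :: complex ^ ('a \<times> 'b::finite) ^ ('b \<times> 'a))) = 2"
proof -
  have "causal_influence (unitary_channel (swap_gate :: complex ^ ('a \<times> 'b) ^ ('b \<times> 'a)))
      = (INF C \<in> (channels :: (('a \<times> 'b) op \<Rightarrow> ('a \<times> 'b) op) set). 2)"
    unfolding causal_influence_def
    by (intro INF_cong refl diamond_norm_swap_conjugate assms)
  also have "\<dots> = 2" using id_channel by (intro cINF_const) auto
  finally show ?thesis .
qed

end
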